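(* Let $\epsilon>0$ be a constant independent of $n$. Place $n$ sensors on $[0,\infty)$ at the first $n$ arrival times $X_1\le\dots\le X_n$ of a homogeneous Poisson process on $[0,\infty)$ with rate $n$. Consider algorithm $MV_1(n,s)$ with $s=\frac{1+\epsilon}{n}$: the first sensor stays at $X_1$ and, for $i=2,\dots,n$, the sensor at $X_i$ is moved to $X_1+(i-1)s$. Then the expected $1$-total movement $\mathbf{E}\left[\sum_{i=2}^n|X_i-X_1-(i-1)s|\right]$ of this algorithm is $\Theta(n)$.
   Context: If the $i$-th sensor is displaced by a distance $|m(i)|$, the $1$-total movement is $\sum_{i=1}^n|m(i)|$. Asymptotics are as $n\to\infty$ with $\epsilon$ fixed. *)

theory Defs
  imports "HOL-Probability.Probability"
begin

text \<open>
  A homogeneous Poisson process on \<open>[0, \<infinity>)\<close> as a counting process: \<open>N t\<close> is the number of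
  arrivals in \<open>[0, t]\<close>. Only times \<open>t \<ge> 0\<close> are constrained. In \<open>independent_increments\<close> and
  \<open>poisson_increments\<close> the subtraction on \<open>nat\<close> does not truncate, because paths are monotone.
  In \<open>right_continuous\<close> the topology on \<open>nat\<close> is the discrete one.
\<close>

locale poisson_process = prob_space M
  for M :: "'a measure" and rate :: real and N :: "real \<Rightarrow> 'a \<Rightarrow> nat" +
  assumes rate_pos: "rate > 0"
    and measurable_count: "\<And>t. 0 \<le> t \<Longrightarrow> N t \<in> measurable M (count_space UNIV)"
    and starts_at_zero: "\<And>\<omega>. \<omega> \<in> space M \<Longrightarrow> N 0 \<omega> = 0"
    and mono_paths: "\<And>\<omega>. \<omega> \<in> space M \<Longrightarrow> mono_on {0..} (\<lambda>t. N t \<omega>)"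
    and right_continuous:
      "\<And>\<omega> t. \<omega> \<in> space M \<Longrightarrow> 0 \<le> t \<Longrightarrow> continuous (at_right t) (\<lambda>u. N u \<omega>)"
    and independent_increments:
      "\<And>(k::nat) (t::nat \<Rightarrow> real). 0 \<le> t 0 \<Longrightarrow> strict_mono_on {..k} t \<Longrightarrow>
         indep_vars (\<lambda>_. count_space UNIV) (\<lambda>j \<omega>. N (t (Suc j)) \<omega> - N (t j) \<omega>) {..<k}"
    and poisson_increments:
      "\<And>u t. 0 \<le> u \<Longrightarrow> u < t \<Longrightarrow>
         distr M (count_space UNIV) (\<lambda>\<omega>. N t \<omega> - N u \<omega>)
           = measure_pmf (poisson_pmf (rate * (t - u)))"

text \<open>
  The \<open>i\<close>-th arrival time (\<open>i \<ge> 1\<close>). The set is nonempty for almost every \<open>\<omega>\<close>; on the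
  exceptional null set the value of the infimum is irrelevant.
\<close>

definition arrival_time :: "(real \<Rightarrow> 'a \<Rightarrow> nat) \<Rightarrow> nat \<Rightarrow> 'a \<Rightarrow> real" where
  "arrival_time N i \<omega> = Inf {t. 0 \<le> t \<and> i \<le> N t \<omega>}"

text \<open>
  Sensors are numbered from \<open>1\<close>. \<open>MV1 s x i\<close> is the final position of sensor \<open>i\<close> when the
  initial positions are \<open>x 1, x 2, \<dots>\<close>.
\<close>

definition MV1 :: "real \<Rightarrow> (nat \<Rightarrow> real) \<Rightarrow> nat \<Rightarrow> real" where
  "MV1 s x i = (if i = 1 then x 1 else x 1 + (real i - 1) * s)"

definition total_movement :: "nat \<Rightarrow> (nat \<Rightarrow> real) \<Rightarrow> (nat \<Rightarrow> real) \<Rightarrow> real" where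
  "total_movement n x y = (\<Sum>i=1..n. \<bar>x i - y i\<bar>)"

lemma total_movement_MV1:
  "total_movement n x (MV1 s x) = (\<Sum>i=2..n. \<bar>x i - x 1 - (real i - 1) * s\<bar>)"
proof (cases "n = 0")
  case False
  then have "{1..n} = insert 1 {2..n}"
    by auto
  then show ?thesis
    by (auto simp: total_movement_def MV1_def algebra_simps intro!: sum.cong)
qed (simp add: total_movement_def)

end

theory Submission
  imports Defs
begin

text \<open>
  The \<open>i\<close>-th arrival time is at most \<open>a\<close> iff at least \<open>i\<close> arrivals are counted in \<open>[0, a]\<close>, so it
  is Erlang distributed and has mean \<open>i / n\<close>. Hence sensor \<open>i\<close> is displaced on average by at least
  \<open>(i - 1) s - (i - 1) / n = (i - 1) \<epsilon> / n\<close>, and summing over \<open>i\<close> gives the lower bound. Since the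
  anchors and the arrival times both have mean \<open>O(1)\<close>, the triangle inequality gives the upper bound.
\<close>

context poisson_process
begin

section \<open>Arrival times as inverses of the counts\<close>

text \<open>Monotone paths make the set under the infimum an upper ray, and right continuity makes
  the ray closed, so the infimum is attained. The witness \<open>t\<close> excludes the empty
  set.\<close>

lemma arrival_time_le_iff:
  assumes \<omega>: "\<omega> \<in> space M" and "0 \<le> a" and t: "0 \<le> t" "i \<le> N t \<omega>"
  shows "arrival_time N i \<omega> \<le> a \<longleftrightarrow> i \<le> N a \<omega>"
proof
  assume "i \<le> N a \<omega>"
  then show "arrival_time N i \<omega> \<le> a"
    unfolding arrival_time_def using \<open>0 \<le> a\<close> by (intro cInf_lower bdd_belowI[of _ 0]) auto
next
  assume le: "arrival_time N i \<omega> \<le> a"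
  show "i \<le> N a \<omega>"
  proof (rule ccontr)
    assume less: "\<not> i \<le> N a \<omega>"
    have "((\<lambda>u. N u \<omega>) \<longlongrightarrow> N a \<omega>) (at_right a)"
      using right_continuous[OF \<omega> \<open>0 \<le> a\<close>] by (simp add: continuous_within)
    \<comment> \<open>In the discrete topology, convergence means being eventually constant. The
      count thus stays below \<open>i\<close> up to some \<open>b > a\<close>, which pushes the
      infimum up to \<open>b\<close>.\<close>
    then have "\<forall>\<^sub>F u in at_right a. N u \<omega> = N a \<omega>"
      by (simp add: tendsto_discrete)
    then obtain b where b: "a < b" "\<And>u. a < u \<Longrightarrow> u < b \<Longrightarrow> N u \<omega> = N a \<omega>"
      unfolding eventually_at_right_field by blast
    have "b \<le> arrival_time N i \<omega>"
      unfolding arrival_time_def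
    proof (rule cInf_greatest)
      show "{t. 0 \<le> t \<and> i \<le> N t \<omega>} \<noteq> {}" using t by auto
    next
      fix u assume u: "u \<in> {t. 0 \<le> t \<and> i \<le> N t \<omega>}"
      have "N u \<omega> \<le> N a \<omega>" if "u \<le> a"
        using mono_paths[OF \<omega>] u that \<open>0 \<le> a\<close> by (auto simp: mono_on_def)
      then show "b \<le> u" using u less b(2)[of u] by force
    qed
    then show False using le b(1) by simp
  qed
qed

section \<open>Poisson counts and the Erlang distribution function\<close>

text \<open>For \<open>t \<ge> 0\<close>, \<open>erlang_CDF k\<close> is defined as one minus the
  Poisson partial sum up to \<open>k\<close>. Its index is the shape minus one: the complementary
  event is that arrival \<open>k + 1\<close> has occurred by time \<open>t\<close>. The case
  \<open>t = 0\<close> is separate because \<open>poisson_increments\<close> needs a positive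
  length.\<close>

lemma prob_count_le:
  assumes "0 \<le> t"
  shows "prob {\<omega> \<in> space M. N t \<omega> \<le> k} = 1 - erlang_CDF k rate t"
proof (cases "t = 0")
  case True
  then have "{\<omega> \<in> space M. N t \<omega> \<le> k} = space M" by (auto simp: starts_at_zero)
  then show ?thesis by (simp add: True prob_space erlang_CDF_at0)
next
  case False
  then have t: "0 < t" using assms by simp
  have "prob {\<omega> \<in> space M. N t \<omega> \<le> k} = measure (distr M (count_space UNIV) (N t)) {..k}"
    using measurable_count[OF assms]
    by (auto simp: measure_distr intro!: arg_cong[where f = prob])
  also have "distr M (count_space UNIV) (N t) =
      distr M (count_space UNIV) (\<lambda>\<omega>. N t \<omega> - N 0 \<omega>)"
    by (intro distr_cong) (auto simp: starts_at_zero)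
  also have "\<dots> = measure_pmf (poisson_pmf (rate * t))"
    using poisson_increments[of 0 t] t by simp
  also have "measure (measure_pmf (poisson_pmf (rate * t))) {..k} =
      (\<Sum>j\<le>k. (rate * t) ^ j * exp (- rate * t) / fact j)"
    using t rate_pos by (subst measure_measure_pmf_finite) auto
  finally show ?thesis
    using t by (simp add: erlang_CDF_def)
qed

text \<open>A finite sum of terms, each a power of \<open>rate * t\<close> divided by
  \<open>exp (rate * t)\<close> up to a constant.\<close>

lemma erlang_CDF_at_top: "((\<lambda>t. 1 - erlang_CDF k rate t) \<longlongrightarrow> 0) at_top"
proof -
  have lim: "filterlim (\<lambda>t. rate * t) at_top at_top"
    by (rule filterlim_tendsto_pos_mult_at_top[OF tendsto_const rate_pos filterlim_ident])
  have "((\<lambda>t. \<Sum>j\<le>k. (rate * t) ^ j / exp (rate * t) / fact j) \<longlongrightarrow> (\<Sum>j\<le>k. 0 / fact j)) at_top"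
    by (intro tendsto_intros filterlim_compose[OF tendsto_power_div_exp_0 lim]) auto
  then have "((\<lambda>t. \<Sum>j\<le>k. (rate * t) ^ j / exp (rate * t) / fact j) \<longlongrightarrow> 0) at_top"
    by simp
  moreover have "\<forall>\<^sub>F t in at_top. (\<Sum>j\<le>k. (rate * t) ^ j / exp (rate * t) / fact j) =
      1 - erlang_CDF k rate t"
    using eventually_ge_at_top[of 0]
    by eventually_elim (auto simp: erlang_CDF_def exp_minus field_simps intro!: sum.cong)
  ultimately show ?thesis by (rule Lim_transform_eventually)
qed

section \<open>Measurability and almost sure unboundedness\<close>

lemma measurable_count_le [measurable]:
  "0 \<le> t \<Longrightarrow> {\<omega> \<in> space M. N t \<omega> \<le> k} \<in> sets M"
  "0 \<le> t \<Longrightarrow> {\<omega> \<in> space M. k \<le> N t \<omega>} \<in> sets M"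
  using measurable_sets[OF measurable_count, of t "{..k}"]
    measurable_sets[OF measurable_count, of t "{k..}"]
  by (simp_all add: vimage_def Int_def conj_commute)

text \<open>A path bounded by \<open>k\<close> satisfies \<open>N m \<le> k\<close> for every
  \<open>m\<close>, and these events have probabilities tending to 0. Hence almost surely the
  infimum defining an arrival time is over a nonempty set.\<close>

lemma AE_count_unbounded: "AE \<omega> in M. \<exists>m::nat. k < N (real m) \<omega>"
proof -
  let ?A = "{\<omega> \<in> space M. \<forall>m::nat. N (real m) \<omega> \<le> k}"
  have A: "?A \<in> sets M"
    by (intro sets.sets_Collect_countable_All measurable_count_le) auto
  have "prob ?A \<le> 1 - erlang_CDF k rate (real m)" for m
    unfolding prob_count_le[OF of_nat_0_le_iff, symmetric]
    by (intro finite_measure_mono measurable_count_le) auto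
  moreover have "(\<lambda>m. 1 - erlang_CDF k rate (real m)) \<longlonglongrightarrow> 0"
    by (rule filterlim_compose[OF erlang_CDF_at_top filterlim_real_sequentially])
  ultimately have "prob ?A \<le> 0"
    by (intro LIMSEQ_le_const) auto
  then have "emeasure M ?A = 0"
    by (simp add: emeasure_eq_measure measure_le_0_iff)
  then show ?thesis
    by (intro AE_I[OF _ _ A]) (auto simp: not_less)
qed

text \<open>When fewer than \<open>i\<close> points ever arrive, the infimum has the junk value \<open>Inf {}\<close>.\<close>

lemma borel_measurable_arrival_time: "arrival_time N i \<in> borel_measurable M"
proof (rule borel_measurableI_le)
  fix a
  \<comment> \<open>Integer times keep the union countable; by monotonicity they detect arrivals at
    all real times.\<close>
  let ?E = "{\<omega> \<in> space M. \<exists>m::nat. i \<le> N (real m) \<omega>}"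
  have E: "?E \<in> sets M"
    by (intro sets.sets_Collect_countable_Ex measurable_count_le) auto
  have E_iff: "\<omega> \<in> ?E" if "\<omega> \<in> space M" "0 \<le> t" "i \<le> N t \<omega>" for \<omega> t
  proof -
    obtain m :: nat where "t \<le> m" using real_arch_simple by blast
    then have "N t \<omega> \<le> N (real m) \<omega>"
      using mono_paths[OF that(1)] that by (auto simp: mono_on_def)
    then show ?thesis using that by (auto intro: order_trans)
  qed
  have in_E: "arrival_time N i \<omega> \<le> a \<longleftrightarrow> 0 \<le> a \<and> i \<le> N a \<omega>" if "\<omega> \<in> ?E" for \<omega>
  proof -
    obtain m :: nat where m: "i \<le> N (real m) \<omega>" using \<open>\<omega> \<in> ?E\<close> by blast
    have "0 \<le> arrival_time N i \<omega>"
      unfolding arrival_time_def using m by (intro cInf_greatest) (auto intro!: exI[of _ "real m"])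
    then show ?thesis
      using arrival_time_le_iff[of \<omega> a "real m" i] that m by auto
  qed
  have out_E: "arrival_time N i \<omega> = Inf {}" if "\<omega> \<in> space M - ?E" for \<omega>
    unfolding arrival_time_def using that E_iff by (intro arg_cong[where f = Inf]) blast
  \<comment> \<open>On \<open>?E\<close> this is an event about the count at \<open>a\<close>; off
    \<open>?E\<close> the arrival time is constant, so the complement is included entirely or not at
    all.\<close>
  have "{\<omega> \<in> space M. arrival_time N i \<omega> \<le> a} =
      (?E \<inter> (if 0 \<le> a then {\<omega> \<in> space M. i \<le> N a \<omega>} else {})) \<union>
      (if Inf {} \<le> a then space M - ?E else {})"
    (is "?L = ?R")
  proof (intro set_eqI)
    fix \<omega>
    show "\<omega> \<in> ?L \<longleftrightarrow> \<omega> \<in> ?R"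
      using in_E[of \<omega>] out_E[of \<omega>] by (cases "\<omega> \<in> ?E") auto
  qed
  also have "\<dots> \<in> sets M"
    using E by auto
  finally show "{\<omega> \<in> space M. arrival_time N i \<omega> \<le> a} \<in> sets M" .
qed

section \<open>Law and mean of the arrival times\<close>

lemma arrival_time_distributed:
  "distributed M lborel (arrival_time N (Suc k)) (erlang_density k rate)"
proof (rule erlang_distributedI[OF borel_measurable_arrival_time rate_pos])
  fix a :: real assume a: "0 \<le> a"
  \<comment> \<open>The two events are compared only almost surely, where arrival
    \<open>Suc k\<close> does occur.\<close>
  have "AE \<omega> in M. \<omega> \<in> {\<omega> \<in> space M. arrival_time N (Suc k) \<omega> \<le> a} \<longleftrightarrow>
      \<omega> \<in> space M - {\<omega> \<in> space M. N a \<omega> \<le> k}"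
    using AE_count_unbounded[of k] AE_space
  proof eventually_elim
    case (elim \<omega>)
    then obtain m :: nat where "Suc k \<le> N (real m) \<omega>" using Suc_leI by blast
    then show ?case
      using arrival_time_le_iff[of \<omega> a "real m" "Suc k"] elim a by auto
  qed
  then have "emeasure M {\<omega> \<in> space M. arrival_time N (Suc k) \<omega> \<le> a} =
      emeasure M (space M - {\<omega> \<in> space M. N a \<omega> \<le> k})"
    using borel_measurable_arrival_time[of "Suc k"] measurable_count_le(1)[OF a]
    by (intro emeasure_eq_AE) auto
  also have "\<dots> = erlang_CDF k rate a"
    using prob_compl[OF measurable_count_le(1)[OF a]] prob_count_le[OF a]
    by (simp add: emeasure_eq_measure)
  finally show "emeasure M {\<omega> \<in> space M. arrival_time N (Suc k) \<omega> \<le> a} = erlang_CDF k rate a" .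
qed

lemma
  assumes "1 \<le> i"
  shows integrable_arrival_time: "integrable M (arrival_time N i)"
    and expectation_arrival_time: "expectation (arrival_time N i) = real i / rate"
    and AE_arrival_time_nonneg: "AE \<omega> in M. 0 \<le> arrival_time N i \<omega>"
proof -
  obtain k where k: "i = Suc k" using assms by (cases i) auto
  note D = arrival_time_distributed[of k]
  show "integrable M (arrival_time N i)"
    using erlang_ith_moment_integrable[OF rate_pos D, of 1] by (simp add: k)
  show "expectation (arrival_time N i) = real i / rate"
    using erlang_ith_moment[OF rate_pos D, of 1] by (simp add: k)
  show "AE \<omega> in M. 0 \<le> arrival_time N i \<omega>"
    unfolding k by (subst distributed_AE2[OF D]) (auto simp: erlang_density_def)
qed

section \<open>Displacement of a single sensor\<close>

text \<open>Below, \<open>\<bar>y\<bar> \<ge> -y\<close> reduces the claim to linearity, since the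
  mean gap between arrivals 1 and \<open>i\<close> is \<open>(i - 1) / rate\<close>. Above, all
  three terms are almost surely nonnegative, so their sum dominates.\<close>

lemma
  assumes "1 \<le> i" "0 \<le> s"
  defines "D \<equiv> \<lambda>\<omega>. \<bar>arrival_time N i \<omega> - arrival_time N 1 \<omega> - (real i - 1) * s\<bar>"
  shows integrable_displacement: "integrable M D"
    and expectation_displacement_ge: "(real i - 1) * (s - 1 / rate) \<le> expectation D"
    and expectation_displacement_le: "expectation D \<le> (real i + 1) / rate + (real i - 1) * s"
proof -
  note int = integrable_arrival_time[OF \<open>1 \<le> i\<close>] integrable_arrival_time[of 1]
  note ex = expectation_arrival_time[OF \<open>1 \<le> i\<close>] expectation_arrival_time[of 1]
  show D: "integrable M D"
    unfolding D_def using int by auto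
  have "(real i - 1) * (s - 1 / rate) =
      expectation (\<lambda>\<omega>. (real i - 1) * s - (arrival_time N i \<omega> - arrival_time N 1 \<omega>))"
    using int ex by (simp add: prob_space diff_divide_distrib algebra_simps)
  also have "\<dots> \<le> expectation D"
    using int D by (intro integral_mono) (auto simp: D_def)
  finally show "(real i - 1) * (s - 1 / rate) \<le> expectation D" .
  have "expectation D \<le>
      expectation (\<lambda>\<omega>. arrival_time N i \<omega> + arrival_time N 1 \<omega> + (real i - 1) * s)"
  proof (rule integral_mono_AE[OF D])
    show "AE \<omega> in M. D \<omega> \<le> arrival_time N i \<omega> + arrival_time N 1 \<omega> + (real i - 1) * s"
      using AE_arrival_time_nonneg[OF \<open>1 \<le> i\<close>] AE_arrival_time_nonneg[OF order_refl]
    proof eventually_elim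
      case (elim \<omega>)
      have "0 \<le> (real i - 1) * s" using assms by simp
      then show ?case using elim unfolding D_def by linarith
    qed
  qed (use int in auto)
  also have "\<dots> = (real i + 1) / rate + (real i - 1) * s"
    using int ex by (simp add: prob_space add_divide_distrib)
  finally show "expectation D \<le> (real i + 1) / rate + (real i - 1) * s" .
qed

end

section \<open>Summing over the sensors\<close>

lemma sum_pred_2: "n \<ge> 1 \<Longrightarrow> (\<Sum>i=2..n. real i - 1) = real n * (real n - 1) / 2"
  by (induction n rule: nat_induct_at_least) (auto simp: field_simps)

theorem theorem2:
  fixes \<epsilon> :: real
    and M :: "nat \<Rightarrow> 'a measure"
    and N :: "nat \<Rightarrow> real \<Rightarrow> 'a \<Rightarrow> nat"
  assumes "\<epsilon> > 0"
    and "\<And>n. n \<ge> 1 \<Longrightarrow> poisson_process (M n) (real n) (N n)"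
  shows "(\<lambda>n. prob_space.expectation (M n)
            (\<lambda>\<omega>. let X = (\<lambda>i. arrival_time (N n) i \<omega>)
                 in total_movement n X (MV1 ((1 + \<epsilon>) / real n) X)))
          \<in> \<Theta>(\<lambda>n. real n)"
    (is "?E \<in> _")
proof -
  have bounds: "\<epsilon> / 4 * real n \<le> ?E n \<and> ?E n \<le> (3 + \<epsilon>) * real n" if n: "n \<ge> 2" for n
  proof -
    interpret poisson_process "M n" "real n" "N n"
      using assms(2) n by simp
    define s where "s = (1 + \<epsilon>) / real n"
    have s: "0 \<le> s" using assms(1) by (simp add: s_def)
    let ?D = "\<lambda>i \<omega>. \<bar>arrival_time (N n) i \<omega> - arrival_time (N n) 1 \<omega> - (real i - 1) * s\<bar>"
    have E: "?E n = (\<Sum>i=2..n. expectation (?D i))"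
      unfolding Let_def total_movement_MV1 s_def[symmetric]
      by (rule Bochner_Integration.integral_sum, rule integrable_displacement) (use s in auto)
    \<comment> \<open>This is \<open>n - 1 \<ge> n / 2\<close>, valid from \<open>n = 2\<close>
      on.\<close>
    have "\<epsilon> / 4 * real n \<le> \<epsilon> / 2 * (real n - 1)"
      using n assms(1) by (simp add: field_simps)
    \<comment> \<open>The target spacing exceeds the mean spacing by
      \<open>s - 1 / n = \<epsilon> / n\<close>.\<close>
    also have "\<dots> = (\<Sum>i=2..n. real i - 1) * (s - 1 / real n)"
      using n by (subst sum_pred_2) (auto simp: s_def field_simps)
    also have "\<dots> \<le> ?E n"
      unfolding E sum_distrib_right
      by (rule sum_mono, rule expectation_displacement_ge) (use s in auto)
    finally have lower: "\<epsilon> / 4 * real n \<le> ?E n" .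
    have "?E n \<le> (\<Sum>i=2..n. 3 + \<epsilon>)"
      unfolding E
    proof (rule sum_mono)
      fix i assume i: "i \<in> {2..n}"
      have "expectation (?D i) \<le> (real i + 1) / real n + (real i - 1) * s"
        using i s by (intro expectation_displacement_le) auto
      \<comment> \<open>From \<open>i \<le> n\<close>: \<open>i + 1 \<le> 2 n\<close> and
        \<open>i - 1 \<le> n\<close>.\<close>
      also have "\<dots> \<le> 2 + 1 * (1 + \<epsilon>)"
      proof (rule add_mono)
        show "(real i + 1) / real n \<le> 2" using i by (simp add: field_simps)
        have "(real i - 1) * s = (real i - 1) / real n * (1 + \<epsilon>)" by (simp add: s_def)
        also have "\<dots> \<le> 1 * (1 + \<epsilon>)"
          using i assms(1) by (intro mult_right_mono) auto
        finally show "(real i - 1) * s \<le> 1 * (1 + \<epsilon>)" .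
      qed
      finally show "expectation (?D i) \<le> 3 + \<epsilon>" by simp
    qed
    also have "\<dots> \<le> (3 + \<epsilon>) * real n"
      using assms(1) n by (simp add: mult.commute of_nat_diff)
    finally show ?thesis using lower by simp
  qed
  show ?thesis
  proof (rule bigthetaI)
    show "?E \<in> O(\<lambda>n. real n)"
    proof (rule bigoI[where c = "3 + \<epsilon>"])
      show "\<forall>\<^sub>F n in sequentially. norm (?E n) \<le> (3 + \<epsilon>) * norm (real n)"
        using eventually_ge_at_top[of 2]
      proof eventually_elim
        case (elim n)
        have "0 \<le> \<epsilon> / 4 * real n" using assms(1) by simp
        then show ?case using bounds[OF elim] unfolding real_norm_def by linarith
      qed
    qed
    show "?E \<in> \<Omega>(\<lambda>n. real n)"
    proof (rule landau_omega.bigI[where c = "\<epsilon> / 4"])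
      show "\<forall>\<^sub>F n in sequentially. \<epsilon> / 4 * norm (real n) \<le> norm (?E n)"
        using eventually_ge_at_top[of 2]
      proof eventually_elim
        case (elim n)
        then show ?case using bounds[OF elim] unfolding real_norm_def by linarith
      qed
    qed (use assms(1) in simp)
  qed
qed

end
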